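(* Let $\Omega$ be a convex subset of a real vector space $X$. If $a\in\mathrm{core}(\Omega)$ and $b\in\mathrm{lin}(\Omega)$, then $[a,b)\subset\mathrm{core}(\Omega)$.
   Context: All vector spaces are real and carry no topology. For $w,x\in X$, $[w,x):=\{w+t(x-w)\mid 0\le t<1\}$; in particular $[w,w)=\{w\}$. For a nonempty set $\Omega\subset X$, the algebraic core is $\mathrm{core}(\Omega):=\{x\in\Omega\mid \forall v\in X\ \exists\delta>0\ \forall t\in\mathbb{R}\text{ with }|t|<\delta:\ x+tv\in\Omega\}$, and the algebraic closure is $\mathrm{lin}(\Omega):=\{x\in X\mid \exists w\in\Omega:\ [w,x)\subset\Omega\}$. *)

theory Defs
  imports "HOL-Analysis.Line_Segment"
begin

text \<open>
  The degenerate case \<open>w = x\<close> yields \<open>{w}\<close>, not the empty set that removing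
  the endpoint \<open>x\<close> from \<^const>\<open>closed_segment\<close> would give.
\<close>

definition half_open_segment :: "'a::real_vector \<Rightarrow> 'a \<Rightarrow> 'a set" where
  "half_open_segment w x = {w + t *\<^sub>R (x - w) | t::real. 0 \<le> t \<and> t < 1}"

definition alg_core :: "'a::real_vector set \<Rightarrow> 'a set" where
  "alg_core \<Omega> =
    {x \<in> \<Omega>. \<forall>v. \<exists>\<delta>>0. \<forall>t::real. \<bar>t\<bar> < \<delta> \<longrightarrow> x + t *\<^sub>R v \<in> \<Omega>}"

definition alg_closure :: "'a::real_vector set \<Rightarrow> 'a set" where
  "alg_closure \<Omega> = {x. \<exists>w\<in>\<Omega>. half_open_segment w x \<subseteq> \<Omega>}"

end

theory Submission
  imports Defs
begin

text \<open>
  For \<open>b \<in> \<Omega>\<close> a segment from a core point stays in the core because a convex combination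
  scales the neighbourhoods of \<open>a\<close>. If only \<open>[w, b) \<subseteq> \<Omega>\<close>, then replacing \<open>b\<close> by
  \<open>b + e (w - b) \<in> \<Omega>\<close> with small \<open>e > 0\<close> can be compensated by moving \<open>a\<close> slightly in the
  direction \<open>b - w\<close>, so \<open>[a, b) \<subseteq> \<Omega>\<close>. A point of \<open>[a, b)\<close> then lies on a segment from \<open>a\<close>
  to a point of \<open>\<Omega>\<close> further along \<open>[a, b)\<close>.
\<close>

lemma convex_half_open_segment_subset_core:
  assumes "convex \<Omega>" "a \<in> alg_core \<Omega>" "y \<in> \<Omega>"
  shows "half_open_segment a y \<subseteq> alg_core \<Omega>"
proof
  fix x assume "x \<in> half_open_segment a y"
  then obtain t where t: "0 \<le> t" "t < 1" and x: "x = (1 - t) *\<^sub>R a + t *\<^sub>R y"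
    by (auto simp: half_open_segment_def algebra_simps)
  have combine: "(1 - t) *\<^sub>R z + t *\<^sub>R y \<in> \<Omega>" if "z \<in> \<Omega>" for z
    using convexD[OF assms(1) that assms(3), of "1 - t" t] t by simp
  have "\<exists>\<delta>>0. \<forall>s::real. \<bar>s\<bar> < \<delta> \<longrightarrow> x + s *\<^sub>R v \<in> \<Omega>" for v
  proof -
    obtain \<delta> where \<delta>: "\<delta> > 0" "\<And>s::real. \<bar>s\<bar> < \<delta> \<Longrightarrow> a + s *\<^sub>R v \<in> \<Omega>"
      using assms(2) unfolding alg_core_def by blast
    \<comment> \<open>The whole displacement of \<open>x\<close> is charged to \<open>a\<close>,
      which has weight \<open>1 - t\<close>; so \<open>a\<close> must move by
      \<open>s / (1 - t)\<close>, and the radius shrinks by the factor \<open>1 - t\<close>.\<close>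
    have "x + s *\<^sub>R v \<in> \<Omega>" if "\<bar>s\<bar> < (1 - t) * \<delta>" for s
    proof -
      have "\<bar>s / (1 - t)\<bar> < \<delta>"
        using that t by (simp add: divide_less_eq mult.commute)
      moreover have "x + s *\<^sub>R v = (1 - t) *\<^sub>R (a + (s / (1 - t)) *\<^sub>R v) + t *\<^sub>R y"
        using t by (simp add: x scaleR_add_right)
      ultimately show ?thesis
        using combine \<delta>(2) by simp
    qed
    then show ?thesis
      using \<delta>(1) t(2) by (intro exI[of _ "(1 - t) * \<delta>"]) simp
  qed
  moreover have "x \<in> \<Omega>"
    using combine[of a] assms(2) by (simp add: x alg_core_def)
  ultimately show "x \<in> alg_core \<Omega>"
    by (simp add: alg_core_def)
qed

text \<open>Since \<open>b\<close> may lie outside \<open>\<Omega>\<close>, it cannot serve as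
  \<open>y\<close> in the preceding lemma; this supplies points of \<open>\<Omega>\<close>
  arbitrarily close to \<open>b\<close> on the segment instead.\<close>

lemma convex_half_open_segment_core_closure_subset:
  assumes "convex \<Omega>" "a \<in> alg_core \<Omega>" "b \<in> alg_closure \<Omega>"
  shows "half_open_segment a b \<subseteq> \<Omega>"
proof
  fix x assume "x \<in> half_open_segment a b"
  then obtain t where t: "0 \<le> t" "t < 1" and x: "x = a + t *\<^sub>R (b - a)"
    by (auto simp: half_open_segment_def)
  obtain w where w: "half_open_segment w b \<subseteq> \<Omega>"
    using assms(3) by (auto simp: alg_closure_def)
  obtain \<delta> where \<delta>: "\<delta> > 0" "\<And>s::real. \<bar>s\<bar> < \<delta> \<Longrightarrow> a + s *\<^sub>R (b - w) \<in> \<Omega>"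
    using assms(2) unfolding alg_core_def by blast
  \<comment> \<open>The bound 1 keeps the parameter \<open>1 - e\<close> in \<open>[0, 1)\<close>;
    the other bound keeps the shift \<open>t * e / (1 - t)\<close> of \<open>a\<close> strictly
    below \<open>\<delta>\<close>.\<close>
  define e where "e = min 1 ((1 - t) * \<delta> / 2)"
  have e: "0 < e" "e \<le> 1"
    using \<delta>(1) t by (auto simp: e_def)
  have "t * e \<le> e"
    using t e by (simp add: mult_left_le_one_le)
  also have "e \<le> (1 - t) * \<delta> / 2"
    by (simp add: e_def)
  also have "\<dots> < (1 - t) * \<delta>"
    using \<delta>(1) t by simp
  finally have "\<bar>t * e / (1 - t)\<bar> < \<delta>"
    using t e by (simp add: divide_less_eq mult.commute)
  then have a': "a + (t * e / (1 - t)) *\<^sub>R (b - w) \<in> \<Omega>"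
    by (rule \<delta>(2))
  have "w + (1 - e) *\<^sub>R (b - w) \<in> half_open_segment w b"
    unfolding half_open_segment_def using e
    by (intro CollectI exI[of _ "1 - e"]) simp
  then have b': "w + (1 - e) *\<^sub>R (b - w) \<in> \<Omega>"
    using w by blast
  \<comment> \<open>The second point is \<open>b - e (b - w)\<close>; after weighting, the two
    displacements are \<open>t * e\<close> and \<open>- t * e\<close> times \<open>b - w\<close> and
    cancel.\<close>
  have "x = (1 - t) *\<^sub>R (a + (t * e / (1 - t)) *\<^sub>R (b - w)) + t *\<^sub>R (w + (1 - e) *\<^sub>R (b - w))"
    using t by (simp add: x scaleR_add_right) (simp add: algebra_simps)
  then show "x \<in> \<Omega>"
    using convexD[OF assms(1) a' b', of "1 - t" t] t by simp
qed

theorem theorem3p7: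
  fixes \<Omega> :: "'a::real_vector set" and a b :: 'a
  assumes "convex \<Omega>"
    and "a \<in> alg_core \<Omega>"
    and "b \<in> alg_closure \<Omega>"
  shows "half_open_segment a b \<subseteq> alg_core \<Omega>"
proof
  fix x assume "x \<in> half_open_segment a b"
  then obtain t where t: "0 \<le> t" "t < 1" and x: "x = a + t *\<^sub>R (b - a)"
    by (auto simp: half_open_segment_def)
  \<comment> \<open>The midpoint of \<open>t\<close> and 1 is positive even for
    \<open>t = 0\<close>, so \<open>t / u\<close> is a valid parameter below 1.\<close>
  define u where "u = (1 + t) / 2"
  have u: "0 < u" "t < u" "u < 1"
    using t by (auto simp: u_def)
  have "a + u *\<^sub>R (b - a) \<in> half_open_segment a b"
    using u by (auto simp: half_open_segment_def)
  then have y: "a + u *\<^sub>R (b - a) \<in> \<Omega>"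
    using convex_half_open_segment_core_closure_subset[OF assms] by blast
  have "x = a + (t / u) *\<^sub>R ((a + u *\<^sub>R (b - a)) - a)"
    using u by (simp add: x)
  then have "x \<in> half_open_segment a (a + u *\<^sub>R (b - a))"
    unfolding half_open_segment_def using t u
    by (intro CollectI exI[of _ "t / u"]) simp
  then show "x \<in> alg_core \<Omega>"
    using convex_half_open_segment_subset_core[OF assms(1,2) y] by blast
qed

end
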